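(* Let $N\ge 1$ be an integer and let $h_0(y),\dots,h_N(y)$ be polynomials with real coefficients, $h_0(y)=1$, $\deg h_i\le \frac N2-\left|\frac N2-i\right|$, such that $h(z,y)=\sum_{i=0}^N h_i(y)z^i$ satisfies $h(z,y)\neq 0$ for all $|z|\le 1$ and all $-1\le y\le 1$. Consider the measure on $[-1,1]^2$ $$d\mu(x,y)=\frac{4}{\pi^2}\frac{\sqrt{1-x^2}\sqrt{1-y^2}}{|h(z,y)|^2}\,dx\,dy,$$ where $x=\frac12(z+1/z)$, $|z|=1$. Let $q_k(x,y)=\sum_{i=0}^N h_i(y)U_{k-i}(x)$. Then for all integers $k\ge 0$ and $n$ with $\lceil\frac{N-2}{2}\rceil\le k\le n$, the polynomial $$p_n^k(x,y)=q_k(x,y)U_{n-k}(y)$$ is orthogonal with respect to $\mu$ to all polynomials of degree less than $(k,n-k)$ in the total degree ordering.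
   Context: $U_n$ is the $n$-th Chebyshev polynomial of the second kind; for $n<0$, $U_n$ is defined by $U_n(x)=-U_{-n-2}(x)$ (so $U_{-1}=0$). Total degree ordering: $(i,j)<_{\rm td}(i_1,j_1)$ iff $i+j<i_1+j_1$, or $i+j=i_1+j_1$ and $i<i_1$; the monomial $x^iy^j$ has degree $(i,j)$. A polynomial has degree less than $(k,n-k)$ if it is a linear combination of monomials $x^iy^j$ with $(i,j)<_{\rm td}(k,n-k)$. For $x\in[-1,1]$ write $x=\cos\theta$, $z=e^{i\theta}$; since $h$ has real coefficients, $|h(z,y)|^2$ is a function of $x$ and $y$. *)

theory Defs
  imports "HOL-Analysis.Analysis" "HOL-Computational_Algebra.Polynomial"
begin

fun chebyshev_U_nat :: "nat \<Rightarrow> real poly" where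
  "chebyshev_U_nat 0 = 1"
| "chebyshev_U_nat (Suc 0) = [:0, 2:]"
| "chebyshev_U_nat (Suc (Suc n)) = [:0, 2:] * chebyshev_U_nat (Suc n) - chebyshev_U_nat n"

definition chebyshev_U :: "int \<Rightarrow> real poly" where
  "chebyshev_U n =
     (if n \<ge> 0 then chebyshev_U_nat (nat n)
      else if n = -1 then 0
      else - chebyshev_U_nat (nat (- n - 2)))"

lemma chebyshev_U_reflect: "chebyshev_U n = - chebyshev_U (- n - 2)"
  by (auto simp: chebyshev_U_def)

lemma chebyshev_U_nat_sin:
  "sin t * poly (chebyshev_U_nat n) (cos t) = sin ((real n + 1) * t)"
proof (induction n rule: chebyshev_U_nat.induct)
  case 1
  then show ?case by simp
next
  case 2
  then show ?case using sin_double[of t] by simp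
next
  case (3 n)
  have "sin ((real n + 3) * t) + sin ((real n + 1) * t) = 2 * cos t * sin ((real n + 2) * t)"
    using sin_add[of "(real n + 2) * t" t] sin_diff[of "(real n + 2) * t" t]
    by (simp add: algebra_simps)
  with 3 show ?case by (simp add: algebra_simps)
qed

text \<open>The total degree ordering on exponents; the pair \<open>(i, j)\<close> stands for the monomial
  \<open>x ^ i * y ^ j\<close>.\<close>

definition td_less :: "nat \<times> nat \<Rightarrow> nat \<times> nat \<Rightarrow> bool"  (infix "<\<^sub>t\<^sub>d" 50) where
  "a <\<^sub>t\<^sub>d b \<longleftrightarrow> fst a + snd a < fst b + snd b \<or> (fst a + snd a = fst b + snd b \<and> fst a < fst b)"

lemma finite_td_less: "finite {a. a <\<^sub>t\<^sub>d b}"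
proof (rule finite_subset)
  show "{a. a <\<^sub>t\<^sub>d b} \<subseteq> {..fst b + snd b} \<times> {..fst b + snd b}"
    by (auto simp: td_less_def)
qed simp

text \<open>Bivariate real polynomials are rendered as functions; the index set of the sum below is
  finite by \<open>finite_td_less\<close>.\<close>

definition poly_degree_less :: "(real \<Rightarrow> real \<Rightarrow> real) \<Rightarrow> nat \<times> nat \<Rightarrow> bool" where
  "poly_degree_less r d \<longleftrightarrow>
     (\<exists>c :: nat \<times> nat \<Rightarrow> real. \<forall>x y. r x y = (\<Sum>(i, j) \<in> {a. a <\<^sub>t\<^sub>d d}. c (i, j) * x ^ i * y ^ j))"

definition hpoly :: "nat \<Rightarrow> (nat \<Rightarrow> real poly) \<Rightarrow> complex \<Rightarrow> real \<Rightarrow> complex" where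
  "hpoly N h z y = (\<Sum>i\<le>N. complex_of_real (poly (h i) y) * z ^ i)"

text \<open>For \<open>x\<close> in \<open>[-1, 1]\<close> the point \<open>z\<close> is \<open>exp (\<i> \<theta>)\<close> with \<open>\<theta> = arccos x\<close>. The other
  solution of \<open>x = (z + 1 / z) / 2\<close> is its conjugate, which gives the same value of
  \<open>cmod (hpoly N h z y)\<close> as the coefficients are real.\<close>

definition mu :: "nat \<Rightarrow> (nat \<Rightarrow> real poly) \<Rightarrow> (real \<times> real) measure" where
  "mu N h = density (restrict_space lborel ({-1..1} \<times> {-1..1}))
     (\<lambda>(x, y). ennreal (4 / pi\<^sup>2 * (sqrt (1 - x\<^sup>2) * sqrt (1 - y\<^sup>2))
                         / (cmod (hpoly N h (cis (arccos x)) y))\<^sup>2))"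

text \<open>Integrability is required explicitly, because the Bochner integral of a non-integrable
  function is \<open>0\<close>.\<close>

definition orthogonal_wrt ::
    "(real \<times> real) measure \<Rightarrow> (real \<Rightarrow> real \<Rightarrow> real) \<Rightarrow> (real \<Rightarrow> real \<Rightarrow> real) \<Rightarrow> bool" where
  "orthogonal_wrt M f g \<longleftrightarrow>
     integrable M (\<lambda>(x, y). f x y * g x y) \<and> (\<integral>(x, y). f x y * g x y \<partial>M) = 0"

definition q :: "nat \<Rightarrow> (nat \<Rightarrow> real poly) \<Rightarrow> nat \<Rightarrow> real \<Rightarrow> real \<Rightarrow> real" where
  "q N h k x y = (\<Sum>i\<le>N. poly (h i) y * poly (chebyshev_U (int k - int i)) x)"

definition p :: "nat \<Rightarrow> (nat \<Rightarrow> real poly) \<Rightarrow> nat \<Rightarrow> nat \<Rightarrow> real \<Rightarrow> real \<Rightarrow> real" where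
  "p N h n k x y = q N h k x y * poly (chebyshev_U (int n - int k)) y"

end

theory Submission
  imports Defs "HOL-Complex_Analysis.Complex_Analysis"
begin

text \<open>For \<open>x = cos \<theta>\<close> and \<open>z = exp (\<i> \<theta>)\<close> we have
  \<open>sin \<theta> * q k x y = Im (z ^ (k + 1) * cnj (h z y))\<close>, so dividing by \<open>(cmod (h z y))\<^sup>2\<close> leaves
  \<open>Im (z ^ (k + 1) / h z y)\<close>. The Fourier coefficients of \<open>1 / h\<close> on the unit circle vanish on
  one side by Cauchy's theorem; on the other side the recurrence expressing \<open>h * (1 / h) = 1\<close>
  shows that they are real polynomials in \<open>y\<close>, the \<open>m\<close>-th of degree at most \<open>m\<close>, because
  \<open>h 0 = 1\<close> and \<open>degree (h i) \<le> i\<close>. Hence integrating \<open>x ^ i * q k x y\<close> in \<open>x\<close> gives a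
  polynomial in \<open>y\<close> of degree at most \<open>i - k\<close>, which is zero for \<open>i < k\<close>. Multiplied by \<open>y ^ j\<close>
  its degree stays below \<open>n - k\<close>, so it is orthogonal to the Chebyshev polynomial of index
  \<open>n - k\<close>.\<close>

section \<open>Trigonometric integrals and orthogonality of the Chebyshev polynomials\<close>

text \<open>The reflection convention for negative indices matches the oddness of the sine, so no
  sign condition on \<open>m\<close> arises; in \<open>q\<close> the index \<open>k - i\<close> can
  be negative.\<close>

lemma sin_mult_chebyshev_U:
  "sin t * poly (chebyshev_U m) (cos t) = sin ((of_int m + 1) * t)"
proof (cases "m \<ge> 0")
  case True
  then show ?thesis
    using chebyshev_U_nat_sin[of t "nat m"] by (simp add: chebyshev_U_def)
next
  case False
  show ?thesis
  proof (cases "m = -1")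
    case False
    with \<open>\<not> m \<ge> 0\<close> have "real (nat (- m - 2)) = - of_int m - 2"
      by simp
    moreover have "sin (- ((of_int m + 1) * t)) = sin ((- of_int m - 2 + 1) * t)"
      by (simp add: algebra_simps)
    ultimately show ?thesis
      using False \<open>\<not> m \<ge> 0\<close> chebyshev_U_nat_sin[of t "nat (- m - 2)"]
      by (simp add: chebyshev_U_def)
  qed (simp add: chebyshev_U_def)
qed

text \<open>The substitution x = cos t reverses orientation, and this sign cancels the one in the
  derivative \<open>- sin t\<close>.\<close>

lemma integral_cos_substitution:
  fixes f :: "real \<Rightarrow> real"
  assumes "continuous_on {-1..1} f"
  shows "integral {-1..1} f = integral {0..pi} (\<lambda>t. sin t * f (cos t))"
proof -
  have "((\<lambda>t. (- sin t) *\<^sub>R f (cos t)) has_integral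
      (integral {cos 0..cos pi} f - integral {cos pi..cos 0} f)) {0..pi}"
    by (rule has_integral_substitution_general[where c = "-1" and d = 1 and s = "{}"])
      (use assms in \<open>auto intro!: continuous_intros derivative_eq_intros\<close>)
  then have "((\<lambda>t. - (sin t * f (cos t))) has_integral (- integral {-1..1} f)) {0..pi}"
    by simp
  then show ?thesis
    by (subst (asm) has_integral_neg_iff) (simp add: integral_unique)
qed

text \<open>Serves to pass from the half circle produced by x = cos t to the full circle, where
  Cauchy's theorem applies.\<close>

lemma integral_symmetric_even:
  fixes f :: "real \<Rightarrow> real"
  assumes "continuous_on {-a..a} f" "0 \<le> a" "\<And>t. f (- t) = f t"
  shows "integral {-a..a} f = 2 * integral {0..a} f"
proof -
  have "integral {-a..0} (\<lambda>t. f (- t)) = integral {0..a} f"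
    using Henstock_Kurzweil_Integration.integral_reflect_real[of a 0 f]
    by simp
  moreover have "integral {-a..0} f + integral {0..a} f = integral {-a..a} f"
    using assms by (intro Henstock_Kurzweil_Integration.integral_combine integrable_continuous_real) auto
  ultimately show ?thesis
    using assms(3) by simp
qed

lemma integral_cis_int:
  "integral {-pi..pi} (\<lambda>t. cis (of_int s * t)) = (if s = 0 then 2 * of_real pi else 0)"
proof (cases "s = 0")
  case False
  define F where "F = (\<lambda>t. exp (\<i> * of_int s * complex_of_real t) / (\<i> * of_int s))"
  have cis: "cis (of_int s * t) = exp (\<i> * of_int s * complex_of_real t)" for t
    by (simp add: cis_conv_exp mult_ac)
  have "((\<lambda>t. cis (of_int s * t)) has_integral F pi - F (-pi)) {-pi..pi}"
  proof (rule fundamental_theorem_of_calculus)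
    fix t
    have "((\<lambda>z. exp (\<i> * of_int s * z) / (\<i> * of_int s)) has_field_derivative
        exp (\<i> * of_int s * complex_of_real t)) (at (of_real t))"
      using False by (auto intro!: derivative_eq_intros)
    then show "(F has_vector_derivative cis (of_int s * t)) (at t within {-pi..pi})"
      unfolding F_def cis
      by (rule has_vector_derivative_real_field)
  qed simp
  moreover have "F pi = F (-pi)"
  proof -
    \<comment> \<open>The endpoint values differ by the factor
      \<open>cis (2 * pi * of_int s)\<close>, which is 1 because \<open>s\<close> is an
      integer.\<close>
    have "cis (of_int s * pi) = cis (of_int s * (-pi)) * cis (2 * pi * of_int s)"
      by (simp only: cis_mult) (simp add: algebra_simps)
    then have "cis (of_int s * pi) = cis (of_int s * (-pi))"
      by simp
    then show ?thesis
      unfolding F_def cis by simp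
  qed
  ultimately show ?thesis
    using False by (simp add: integral_unique)
qed (simp add: scaleR_conv_of_real)

text \<open>The bound is an integer so that a negative one expresses \<open>P = 0\<close>.\<close>

definition deg_le :: "int \<Rightarrow> real poly \<Rightarrow> bool" where
  "deg_le d P \<longleftrightarrow> (\<forall>m. d < int m \<longrightarrow> coeff P m = 0)"

lemma deg_le_mult:
  assumes "degree P \<le> i" "deg_le d Q"
  shows "deg_le (int i + d) (P * Q)"
  unfolding deg_le_def
proof (intro allI impI)
  fix m :: nat
  assume m: "int i + d < int m"
  have "coeff P j * coeff Q (m - j) = 0" if "j \<le> m" for j
  proof (cases "j \<le> i")
    case True
    with m that have "d < int (m - j)" by linarith
    then show ?thesis using assms(2) by (simp add: deg_le_def)
  next
    case False
    then show ?thesis using assms(1) by (simp add: coeff_eq_0)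
  qed
  then show "coeff (P * Q) m = 0"
    unfolding coeff_mult by (intro sum.neutral) auto
qed

text \<open>A factor \<open>cos t\<close> replaces the sine by the mean of those with
  \<open>m + 1\<close> and \<open>m - 1\<close>, so it costs at most one unit of \<open>m\<close>;
  the assumption keeps \<open>m\<close> positive down to \<open>l = 0\<close>.\<close>

lemma integral_power_cos_sin_sin:
  assumes "int l < m"
  shows "((\<lambda>t. cos t ^ l * (sin t * sin ((of_int m + 1) * t))) has_integral 0) {0..pi}"
  using assms
proof (induction l arbitrary: m)
  case 0
  \<comment> \<open>Antiderivative of the integrand in product-to-sum form; \<open>m > 0\<close>
    makes both denominators nonzero.\<close>
  define F :: "real \<Rightarrow> real" where "F = (\<lambda>t. sin (of_int m * t) / (2 * of_int m)
    - sin ((of_int m + 2) * t) / (2 * (of_int m + 2)))"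
  have "((\<lambda>t. sin t * sin ((of_int m + 1) * t)) has_integral F pi - F 0) {0..pi}"
  proof (rule fundamental_theorem_of_calculus)
    fix t :: real
    have deriv: "((\<lambda>t. sin (a * t) / (2 * a)) has_real_derivative cos (a * t) / 2)
        (at t within {0..pi})" if "a \<noteq> 0" for a
      using that by (auto intro!: derivative_eq_intros)
    have "(F has_real_derivative cos (of_int m * t) / 2 - cos ((of_int m + 2) * t) / 2)
        (at t within {0..pi})"
      unfolding F_def by (intro DERIV_diff deriv) (use 0 in auto)
    moreover have "sin t * sin ((of_int m + 1) * t)
        = cos (of_int m * t) / 2 - cos ((of_int m + 2) * t) / 2"
      using cos_add[of "(of_int m + 1) * t" t] cos_diff[of "(of_int m + 1) * t" t]
      by (simp add: algebra_simps)
    ultimately have "(F has_real_derivative sin t * sin ((of_int m + 1) * t)) (at t within {0..pi})"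
      by simp
    then show "(F has_vector_derivative sin t * sin ((of_int m + 1) * t)) (at t within {0..pi})"
      by (simp add: has_real_derivative_iff_has_vector_derivative)
  qed simp
  moreover have "sin (of_int m * pi) = 0" "sin ((of_int m + 2) * pi) = 0"
    using sin_times_pi_eq_0[of "of_int m"] sin_times_pi_eq_0[of "of_int m + 2"]
    by auto
  ultimately show ?case
    by (simp add: F_def)
next
  case (Suc l)
  have "((\<lambda>t. (cos t ^ l * (sin t * sin ((of_int (m + 1) + 1) * t))
      + cos t ^ l * (sin t * sin ((of_int (m - 1) + 1) * t))) / 2) has_integral (0 + 0) / 2) {0..pi}"
    by (intro has_integral_divide has_integral_add Suc.IH) (use Suc.prems in auto)
  moreover have "(cos t ^ l * (sin t * sin ((of_int (m + 1) + 1) * t))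
      + cos t ^ l * (sin t * sin ((of_int (m - 1) + 1) * t))) / 2
    = cos t ^ Suc l * (sin t * sin ((of_int m + 1) * t))" for t :: real
  proof -
    have "sin ((of_int (m + 1) + 1) * t) + sin ((of_int (m - 1) + 1) * t)
        = 2 * cos t * sin ((of_int m + 1) * t)"
      using sin_add[of "(of_int m + 1) * t" t] sin_diff[of "(of_int m + 1) * t" t]
      by (simp add: algebra_simps)
    then show ?thesis
      by (simp flip: distrib_left)
  qed
  ultimately show ?case
    by simp
qed

text \<open>With y = cos t, the weight and the substitution give one \<open>sin t\<close> each; one
  of them turns \<open>chebyshev_U m\<close> into a sine, and the preceding integral disposes of
  each power of \<open>cos t\<close>.\<close>

lemma integral_chebyshev_U_orthogonal:
  assumes "deg_le d P" "d < m"
  shows "integral {-1..1} (\<lambda>y. sqrt (1 - y\<^sup>2) * poly (chebyshev_U m) y * poly P y) = 0"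
proof -
  have "((\<lambda>t. coeff P l * (cos t ^ l * (sin t * sin ((of_int m + 1) * t)))) has_integral 0) {0..pi}"
    for l
  proof (cases "int l < m")
    case True
    then show ?thesis
      using has_integral_mult_right[OF integral_power_cos_sin_sin] by fastforce
  next
    case False
    then have "coeff P l = 0"
      using assms by (simp add: deg_le_def)
    then show ?thesis by simp
  qed
  then have "((\<lambda>t. \<Sum>l\<le>degree P. coeff P l * (cos t ^ l * (sin t * sin ((of_int m + 1) * t))))
      has_integral (\<Sum>l\<le>degree P. 0)) {0..pi}"
    by (intro has_integral_sum) auto
  then have "((\<lambda>t. poly P (cos t) * (sin t * sin ((of_int m + 1) * t))) has_integral 0) {0..pi}"
    by (simp add: poly_altdef sum_distrib_left sum_distrib_right mult_ac)
  then have "integral {0..pi} (\<lambda>t. poly P (cos t) * (sin t * sin ((of_int m + 1) * t))) = 0"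
    by (rule integral_unique)
  moreover have "integral {-1..1} (\<lambda>y. sqrt (1 - y\<^sup>2) * poly (chebyshev_U m) y * poly P y)
    = integral {0..pi} (\<lambda>t. sin t *
        (sqrt (1 - (cos t)\<^sup>2) * poly (chebyshev_U m) (cos t) * poly P (cos t)))"
    by (rule integral_cos_substitution) (intro continuous_intros)
  moreover have "\<dots> = integral {0..pi} (\<lambda>t. poly P (cos t) * (sin t * sin ((of_int m + 1) * t)))"
  proof (rule integral_cong)
    fix t assume "t \<in> {0..pi}"
    then have "sqrt (1 - (cos t)\<^sup>2) = sin t"
      by (intro sin_cos_sqrt[symmetric] sin_ge_zero) auto
    then show "sin t * (sqrt (1 - (cos t)\<^sup>2) * poly (chebyshev_U m) (cos t) * poly P (cos t))
      = poly P (cos t) * (sin t * sin ((of_int m + 1) * t))"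
      by (simp flip: sin_mult_chebyshev_U)
  qed
  ultimately show ?thesis
    by simp
qed

section \<open>Fourier coefficients of \<open>1 / h\<close> as polynomials in
  \<open>y\<close>\<close>

locale stable_polynomial =
  fixes N :: nat and h :: "nat \<Rightarrow> real poly"
  assumes h_0: "h 0 = 1"
    and degree_h: "\<And>i. i \<le> N \<Longrightarrow> degree (h i) \<le> i"
    and hpoly_nonzero: "\<And>z y. cmod z \<le> 1 \<Longrightarrow> -1 \<le> y \<Longrightarrow> y \<le> 1 \<Longrightarrow> hpoly N h z y \<noteq> 0"
begin

lemma continuous_hpoly [continuous_intros]:
  fixes f :: "'a::topological_space \<Rightarrow> complex" and g :: "'a \<Rightarrow> real"
  assumes "continuous_on A f" "continuous_on A g"
  shows "continuous_on A (\<lambda>x. hpoly N h (f x) (g x))"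
  unfolding hpoly_def by (intro continuous_intros assms)

lemma hpoly_cis_nonzero [simp]: "-1 \<le> y \<Longrightarrow> y \<le> 1 \<Longrightarrow> hpoly N h (cis t) y \<noteq> 0"
  by (simp add: hpoly_nonzero)

lemma cnj_hpoly: "cnj (hpoly N h z y) = hpoly N h (cnj z) y"
  by (simp add: hpoly_def)

text \<open>For \<open>y\<close> in [-1, 1] this is 2 pi times the Fourier coefficient of
  \<open>1 / h\<close> with index \<open>- s\<close>.\<close>

definition moment :: "int \<Rightarrow> real \<Rightarrow> complex" where
  "moment s y = integral {-pi..pi} (\<lambda>t. cis (of_int s * t) / hpoly N h (cis t) y)"

lemma integrable_moment:
  assumes "-1 \<le> y" "y \<le> 1"
  shows "(\<lambda>t. cis (of_int s * t) / hpoly N h (cis t) y) integrable_on {-pi..pi}"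
  by (intro integrable_continuous_real continuous_intros) (use assms in auto)

text \<open>Cauchy's theorem for z^(s-1) / h, which is regular because \<open>h\<close> has no zero
  in the closed disc; the missing power of z comes from dz = i z dt.\<close>

lemma moment_pos:
  assumes y: "-1 \<le> y" "y \<le> 1" and "s > 0"
  shows "moment s y = 0"
proof -
  define f where "f = (\<lambda>z. z ^ (nat s - 1) / hpoly N h z y)"
  have "(f has_contour_integral 0) (part_circlepath 0 1 (-pi) pi)"
  proof (rule Cauchy_theorem_convex[where S = "cball 0 1" and K = "{}"])
    show "continuous_on (cball 0 1) f"
      unfolding f_def by (intro continuous_intros) (use hpoly_nonzero y in auto)
    show "f field_differentiable at z" if "z \<in> interior (cball 0 1) - {}" for z
    proof -
      have "hpoly N h z y \<noteq> 0"
        using that hpoly_nonzero y by auto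
      then show ?thesis
        unfolding f_def hpoly_def by (intro derivative_intros) auto
    qed
    show "path_image (part_circlepath 0 1 (-pi) pi) \<subseteq> cball 0 1"
      using path_image_part_circlepath_subset[of "-pi" pi 1 0] by auto
    show "pathfinish (part_circlepath 0 1 (-pi) pi) = pathstart (part_circlepath 0 1 (-pi) pi)"
      by (simp add: exp_minus)
  qed auto
  then have "((\<lambda>t. f (cis t) * \<i> * cis t) has_integral 0) {-pi..pi}"
    by (subst (asm) has_contour_integral_part_circlepath_iff) auto
  moreover have "f (cis t) * \<i> * cis t = \<i> * (cis (of_int s * t) / hpoly N h (cis t) y)" for t
  proof -
    have "cis t ^ (nat s - 1) * cis t = cis (of_int s * t)"
      using \<open>s > 0\<close> by (simp add: Complex.DeMoivre cis_mult of_nat_diff algebra_simps)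
    then show ?thesis
      by (simp add: f_def mult_ac)
  qed
  ultimately have "((\<lambda>t. \<i> * (cis (of_int s * t) / hpoly N h (cis t) y)) has_integral 0) {-pi..pi}"
    by simp
  from has_integral_mult_right[OF this, of "-\<i>"] show ?thesis
    unfolding moment_def by (simp add: integral_unique flip: mult.assoc)
qed

text \<open>This is \<open>h * (1 / h) = 1\<close> read on Fourier coefficients: the shifts by
  \<open>i\<close> supply the powers of z that reassemble \<open>h\<close> in the numerator.\<close>

lemma moment_recurrence:
  assumes y: "-1 \<le> y" "y \<le> 1"
  shows "(\<Sum>i\<le>N. of_real (poly (h i) y) * moment (s + int i) y) =
    (if s = 0 then 2 * of_real pi else 0)"
proof -
  have "(\<Sum>i\<le>N. of_real (poly (h i) y) * moment (s + int i) y) =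
      integral {-pi..pi} (\<lambda>t. \<Sum>i\<le>N. of_real (poly (h i) y) *
        (cis (of_int (s + int i) * t) / hpoly N h (cis t) y))"
    unfolding moment_def
    by (subst integral_sum)
      (simp_all only: integrable_on_mult_right integrable_moment y finite_atMost integral_mult_right)
  also have "(\<lambda>t. \<Sum>i\<le>N. of_real (poly (h i) y) *
        (cis (of_int (s + int i) * t) / hpoly N h (cis t) y)) = (\<lambda>t. cis (of_int s * t))"
  proof
    fix t
    have "cis (of_int (s + int i) * t) = cis (of_int s * t) * cis t ^ i" for i
      by (simp add: Complex.DeMoivre cis_mult algebra_simps)
    then have "(\<Sum>i\<le>N. of_real (poly (h i) y) *
        (cis (of_int (s + int i) * t) / hpoly N h (cis t) y))
      = cis (of_int s * t) * (\<Sum>i\<le>N. of_real (poly (h i) y) * cis t ^ i) / hpoly N h (cis t) y"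
      by (simp only: sum_distrib_left sum_divide_distrib) (simp only: times_divide_eq_right mult_ac)
    then show "(\<Sum>i\<le>N. of_real (poly (h i) y) *
        (cis (of_int (s + int i) * t) / hpoly N h (cis t) y)) = cis (of_int s * t)"
      using y by (simp only: hpoly_def[symmetric]) simp
  qed
  finally show ?thesis
    by (simp add: integral_cis_int)
qed

text \<open>As \<open>h 0 = 1\<close>, the recurrence expresses \<open>moment s\<close> through
  moments of larger index, which vanish once the index is positive. The bound reproduces itself,
  since i - (s + i) = - s.\<close>

lemma moment_poly:
  "\<exists>P. deg_le (- s) P \<and> (\<forall>y\<in>{-1..1}. moment s y = of_real (poly P y))"
proof (induction "nat (1 - s)" arbitrary: s rule: less_induct)
  case less
  show ?case
  proof (cases "s > 0")
    case True
    then show ?thesis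
      using moment_pos by (intro exI[of _ 0]) (auto simp: deg_le_def)
  next
    case False
    have "\<exists>P. deg_le (- (s + int i)) P \<and> (\<forall>y\<in>{-1..1}. moment (s + int i) y = of_real (poly P y))"
      if "i > 0" for i :: nat
      using less[of "s + int i"] False that by auto
    then obtain P where P: "\<And>i. i > 0 \<Longrightarrow> deg_le (- (s + int i)) (P i)"
      "\<And>i y. i > 0 \<Longrightarrow> y \<in> {-1..1} \<Longrightarrow> moment (s + int i) y = of_real (poly (P i) y)"
      by metis
    \<comment> \<open>\<open>Q\<close> solves the recurrence for its term \<open>i = 0\<close>. The
      constant \<open>c\<close> respects the bound \<open>- s\<close> because
      \<open>s \<le> 0\<close> in this case.\<close>
    define c where "c = (if s = 0 then 2 * pi else 0)"
    define Q where "Q = [:c:] - (\<Sum>i=1..N. h i * P i)"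
    have "deg_le (int i + - (s + int i)) (h i * P i)" if "i \<in> {1..N}" for i
      using that by (intro deg_le_mult degree_h P) auto
    then have "deg_le (- s) Q"
      using False
      by (auto simp: deg_le_def Q_def c_def coeff_sum coeff_pCons split: nat.splits)
    moreover have "moment s y = of_real (poly Q y)" if "y \<in> {-1..1}" for y
    proof -
      have "moment s y + (\<Sum>i=1..N. of_real (poly (h i) y) * moment (s + int i) y) = of_real c"
        using moment_recurrence[of y s] that
        by (simp add: c_def h_0 atMost_atLeast0 sum.atLeast_Suc_atMost)
      also have "(\<Sum>i=1..N. of_real (poly (h i) y) * moment (s + int i) y)
          = of_real (\<Sum>i=1..N. poly (h i) y * poly (P i) y)"
        using that by (simp add: P)
      finally show ?thesis
        by (simp add: Q_def poly_sum eq_diff_eq)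
    qed
    ultimately show ?thesis
      by blast
  qed
qed

text \<open>The substitution \<open>x = cos t\<close> turns \<open>x ^ i\<close> times the weight \<open>sqrt (1 - x\<^sup>2)\<close> into
  \<open>cos t ^ i * sin t\<close> and a second \<open>sin t\<close>, which is absorbed into the imaginary part of
  \<open>cis (s * t) / h\<close>.\<close>

definition power_moment :: "nat \<Rightarrow> int \<Rightarrow> real \<Rightarrow> complex" where
  "power_moment i s y =
    integral {-pi..pi} (\<lambda>t. of_real (cos t ^ i * sin t) * (cis (of_int s * t) / hpoly N h (cis t) y))"

lemma integrable_power_moment:
  assumes "-1 \<le> y" "y \<le> 1"
  shows "(\<lambda>t. of_real (cos t ^ i * sin t) * (cis (of_int s * t) / hpoly N h (cis t) y))
    integrable_on {-pi..pi}"
  by (intro integrable_continuous_real continuous_intros) (use assms in auto)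

text \<open>The factor \<open>sin t\<close> gives i/2 times a difference of moments, of which
  \<open>s - 1\<close> has the larger bound 1 - s. Each \<open>cos t\<close> averages the indices
  \<open>s + 1\<close> and \<open>s - 1\<close>, raising the bound by one.\<close>

lemma power_moment_poly:
  "\<exists>P. deg_le (int i - s + 1) P \<and> (\<forall>y\<in>{-1..1}. power_moment i s y = \<i> * of_real (poly P y))"
proof (induction i arbitrary: s)
  case 0
  obtain P Q where P: "deg_le (- (s + 1)) P" "\<And>y. y\<in>{-1..1} \<Longrightarrow> moment (s + 1) y = of_real (poly P y)"
    and Q: "deg_le (- (s - 1)) Q" "\<And>y. y\<in>{-1..1} \<Longrightarrow> moment (s - 1) y = of_real (poly Q y)"
    using moment_poly[of "s + 1"] moment_poly[of "s - 1"] by metis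
  have "power_moment 0 s y = \<i> * of_real (poly (smult (1/2) (Q - P)) y)" if y: "y \<in> {-1..1}" for y
  proof -
    have "power_moment 0 s y = integral {-pi..pi} (\<lambda>t. (\<i> / 2) *
        (cis (of_int (s - 1) * t) / hpoly N h (cis t) y - cis (of_int (s + 1) * t) / hpoly N h (cis t) y))"
      unfolding power_moment_def
    proof (rule integral_cong)
      fix t
      have "of_real (sin t) * cis (of_int s * t) =
          (\<i> / 2) * (cis (of_int (s - 1) * t) - cis (of_int (s + 1) * t))"
        by (simp add: complex_eq_iff ring_distribs cos_add cos_diff sin_add sin_diff field_simps)
      then show "of_real (cos t ^ 0 * sin t) * (cis (of_int s * t) / hpoly N h (cis t) y) = (\<i> / 2) *
        (cis (of_int (s - 1) * t) / hpoly N h (cis t) y - cis (of_int (s + 1) * t) / hpoly N h (cis t) y)"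
        by (metis (no_types, lifting) diff_divide_distrib mult_1 power_0 times_divide_eq_right)
    qed
    also have "\<dots> = (\<i> / 2) * (moment (s - 1) y - moment (s + 1) y)"
      using y unfolding moment_def
      by (simp only: integral_mult_right Henstock_Kurzweil_Integration.integral_diff
          integrable_moment atLeastAtMost_iff)
    finally show ?thesis
      using y by (simp add: P Q)
  qed
  moreover have "deg_le (int 0 - s + 1) (smult (1/2) (Q - P))"
    using P(1) Q(1) by (auto simp: deg_le_def)
  ultimately show ?case
    by blast
next
  case (Suc i)
  obtain P Q where
    P: "deg_le (int i - (s + 1) + 1) P" "\<And>y. y\<in>{-1..1} \<Longrightarrow> power_moment i (s + 1) y = \<i> * of_real (poly P y)"
    and Q: "deg_le (int i - (s - 1) + 1) Q" "\<And>y. y\<in>{-1..1} \<Longrightarrow> power_moment i (s - 1) y = \<i> * of_real (poly Q y)"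
    using Suc[of "s + 1"] Suc[of "s - 1"] by metis
  have "power_moment (Suc i) s y = \<i> * of_real (poly (smult (1/2) (P + Q)) y)" if y: "y \<in> {-1..1}" for y
  proof -
    have "power_moment (Suc i) s y = integral {-pi..pi} (\<lambda>t. (1 / 2) *
        (of_real (cos t ^ i * sin t) * (cis (of_int (s + 1) * t) / hpoly N h (cis t) y)
         + of_real (cos t ^ i * sin t) * (cis (of_int (s - 1) * t) / hpoly N h (cis t) y)))"
      unfolding power_moment_def
    proof (rule integral_cong)
      fix t
      have *: "of_real (cos t) * cis (of_int s * t) =
          (1 / 2) * (cis (of_int (s + 1) * t) + cis (of_int (s - 1) * t))"
        by (simp add: complex_eq_iff ring_distribs cos_add cos_diff sin_add sin_diff field_simps)
      have "of_real (cos t ^ Suc i * sin t) * (cis (of_int s * t) / hpoly N h (cis t) y)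
        = of_real (cos t ^ i * sin t) * ((of_real (cos t) * cis (of_int s * t)) / hpoly N h (cis t) y)"
        by (simp add: mult_ac)
      also note *
      finally show "of_real (cos t ^ Suc i * sin t) * (cis (of_int s * t) / hpoly N h (cis t) y)
        = (1 / 2) *
        (of_real (cos t ^ i * sin t) * (cis (of_int (s + 1) * t) / hpoly N h (cis t) y)
         + of_real (cos t ^ i * sin t) * (cis (of_int (s - 1) * t) / hpoly N h (cis t) y))"
        by (simp add: ring_distribs add_divide_distrib)
    qed
    also have "\<dots> = (1 / 2) * (power_moment i (s + 1) y + power_moment i (s - 1) y)"
      using y unfolding power_moment_def
      by (simp only: integral_mult_right Henstock_Kurzweil_Integration.integral_add
          integrable_power_moment atLeastAtMost_iff)
    finally show ?thesis
      using y by (simp add: P Q ring_distribs)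
  qed
  moreover have "deg_le (int (Suc i) - s + 1) (smult (1/2) (P + Q))"
    using P(1) Q(1) by (auto simp: deg_le_def)
  ultimately show ?case
    by blast
qed

section \<open>Integrating \<open>q\<close> against powers of x\<close>

text \<open>On the circle the conjugate of \<open>h\<close> is the sum of the h_i z^(-i), so the
  factor z^(k+1) produces exactly the frequencies k - i + 1 of the sines.\<close>

lemma sin_mult_q:
  "sin t * q N h k (cos t) y = Im (cis ((of_nat k + 1) * t) * cnj (hpoly N h (cis t) y))"
proof -
  have "sin t * q N h k (cos t) y = (\<Sum>i\<le>N. poly (h i) y * sin ((of_nat k - of_nat i + 1) * t))"
    unfolding q_def sum_distrib_left
    using sin_mult_chebyshev_U[of t "int k - int i" for i]
    by (intro sum.cong refl) (simp add: mult.left_commute)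
  also have "\<dots> = Im (\<Sum>i\<le>N. of_real (poly (h i) y) * cis ((of_nat k - of_nat i + 1) * t))"
    by simp
  also have "(\<Sum>i\<le>N. of_real (poly (h i) y) * cis ((of_nat k - of_nat i + 1) * t))
      = cis ((of_nat k + 1) * t) * cnj (hpoly N h (cis t) y)"
    unfolding cnj_hpoly cis_cnj unfolding hpoly_def sum_distrib_left
    by (intro sum.cong refl) (simp add: Complex.DeMoivre cis_mult mult.left_commute algebra_simps)
  finally show ?thesis .
qed

lemma integral_q:
  assumes y: "-1 \<le> y" "y \<le> 1"
  shows "integral {-1..1} (\<lambda>x. x ^ i * q N h k x y *
      (sqrt (1 - x\<^sup>2) / (cmod (hpoly N h (cis (arccos x)) y))\<^sup>2))
    = Im (power_moment i (int k + 1) y) / 2"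
proof -
  define G where "G = (\<lambda>t. of_real (cos t ^ i * sin t) *
    (cis (of_int (int k + 1) * t) / hpoly N h (cis t) y))"
  have contG: "continuous_on A G" for A
    unfolding G_def by (intro continuous_intros) (use y in auto)
  have "integral {-1..1} (\<lambda>x. x ^ i * q N h k x y *
      (sqrt (1 - x\<^sup>2) / (cmod (hpoly N h (cis (arccos x)) y))\<^sup>2))
    = integral {0..pi} (\<lambda>t. sin t * (cos t ^ i * q N h k (cos t) y *
      (sqrt (1 - (cos t)\<^sup>2) / (cmod (hpoly N h (cis (arccos (cos t))) y))\<^sup>2)))"
    unfolding q_def by (rule integral_cos_substitution) (intro continuous_intros, use y in auto)
  also have "\<dots> = integral {0..pi} (\<lambda>t. Im (G t))"
  proof (rule integral_cong)
    fix t assume t: "t \<in> {0..pi}"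
    let ?H = "hpoly N h (cis t) y"
    have "sqrt (1 - (cos t)\<^sup>2) = sin t"
      using t by (intro sin_cos_sqrt[symmetric] sin_ge_zero) auto
    \<comment> \<open>On the half circle the point z chosen in \<open>mu\<close> is therefore
      \<open>cis t\<close>.\<close>
    moreover have "arccos (cos t) = t"
      using t by (intro arccos_cos) auto
    moreover have "cis ((of_nat k + 1) * t) / ?H =
        cis ((of_nat k + 1) * t) * cnj ?H / of_real ((cmod ?H)\<^sup>2)"
      by (subst complex_div_cnj) simp
    then have "Im (G t) = cos t ^ i * sin t * ((sin t * q N h k (cos t) y) / (cmod ?H)\<^sup>2)"
      unfolding G_def sin_mult_q by (simp del: of_real_power of_real_mult)
    ultimately show "sin t * (cos t ^ i * q N h k (cos t) y *
      (sqrt (1 - (cos t)\<^sup>2) / (cmod (hpoly N h (cis (arccos (cos t))) y))\<^sup>2)) = Im (G t)"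
      by simp
  qed
  also have "\<dots> = integral {-pi..pi} (\<lambda>t. Im (G t)) / 2"
  proof -
    \<comment> \<open>The sign comes from the odd factor \<open>sin t\<close>; it makes
      \<open>Im (G t)\<close> even, whence the factor 1/2.\<close>
    have "G (- t) = - cnj (G t)" for t
      by (simp add: G_def cnj_hpoly cis_cnj)
    then show ?thesis
      by (subst integral_symmetric_even) (auto intro!: continuous_intros contG)
  qed
  also have "integral {-pi..pi} (\<lambda>t. Im (G t)) = Im (integral {-pi..pi} G)"
    using integral_linear[OF integrable_continuous_real[OF contG] bounded_linear_Im, of "-pi" pi]
    by (simp add: o_def)
  finally show ?thesis
    by (simp add: power_moment_def G_def)
qed

section \<open>Integrals with respect to \<open>mu\<close> as iterated integrals\<close>

definition weight :: "real \<times> real \<Rightarrow> real" where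
  "weight = (\<lambda>(x, y). 4 / pi\<^sup>2 * (sqrt (1 - x\<^sup>2) * sqrt (1 - y\<^sup>2))
                         / (cmod (hpoly N h (cis (arccos x)) y))\<^sup>2)"

lemma continuous_weight: "continuous_on ({-1..1} \<times> {-1..1}) weight"
  unfolding weight_def case_prod_beta by (intro continuous_intros) auto

text \<open>Since \<open>h\<close> has no zero for |z| = 1 and \<open>y\<close> in [-1, 1], the
  density is continuous on the compact square; this gives integrability and Fubini's
  theorem.\<close>

lemma
  assumes f: "continuous_on UNIV f"
  shows integrable_mu: "integrable (mu N h) f"
    and integral_mu: "integral\<^sup>L (mu N h) f =
      integral {-1..1} (\<lambda>y. integral {-1..1} (\<lambda>x. weight (x, y) * f (x, y)))"
proof -
  let ?S = "{-1..1::real} \<times> {-1..1::real}"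
  let ?R = "restrict_space lborel ?S"
  have mu: "mu N h = density ?R (\<lambda>x. ennreal (weight x))"
    unfolding mu_def weight_def by (intro arg_cong2[where f = density] ext refl) auto
  have S: "compact ?S" "?S \<in> sets lborel"
    by (auto intro!: compact_Times borel_compact)
  have sets: "sets ?R = sets (restrict_space borel ?S)"
    by (intro sets_restrict_space_cong) simp
  have meas: "weight \<in> borel_measurable ?R" "f \<in> borel_measurable ?R"
    using borel_measurable_continuous_on_restrict[OF continuous_weight]
      borel_measurable_continuous_on_restrict[OF continuous_on_subset[OF f, of ?S]]
    by (auto simp: measurable_cong_sets[OF sets refl])
  have nonneg: "AE x in ?R. 0 \<le> weight x"
    by (intro AE_I2)
      (auto simp: space_restrict_space weight_def abs_square_le_1 intro!: divide_nonneg_nonneg mult_nonneg_nonneg)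
  have cont: "continuous_on ?S (\<lambda>x. weight x * f x)"
    by (intro continuous_intros continuous_weight continuous_on_subset[OF f]) auto
  have int: "integrable lborel (\<lambda>x. indicator ?S x *\<^sub>R (weight x * f x))"
    by (rule borel_integrable_compact[OF S(1) cont])
  then show "integrable (mu N h) f"
    unfolding mu using S meas nonneg
    by (subst integrable_density) (auto simp: integrable_restrict_space)
  have "integral\<^sup>L (mu N h) f = (\<integral>x. indicator ?S x *\<^sub>R (weight x * f x) \<partial>lborel)"
    unfolding mu using S meas nonneg
    by (subst integral_density) (auto simp: integral_restrict_space)
  also have "\<dots> = integral ?S (\<lambda>x. weight x * f x)"
    using set_borel_integral_eq_integral(2)[of ?S "\<lambda>x. weight x * f x"] int
    by (simp add: set_integrable_def set_lebesgue_integral_def)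
  also have "\<dots> = integral {-1..1} (\<lambda>x. integral {-1..1} (\<lambda>y. weight (x, y) * f (x, y)))"
    using integral_prod_continuous[of "-1" "-1" 1 1 "\<lambda>x. weight x * f x"] cont
    by (simp add: cbox_Pair_eq)
  \<comment> \<open>The integral over x has to be the inner one: it is what produces a polynomial in
    \<open>y\<close>.\<close>
  also have "\<dots> = integral {-1..1} (\<lambda>y. integral {-1..1} (\<lambda>x. weight (x, y) * f (x, y)))"
    using integral_swap_continuous[of "-1" "-1" 1 1 "\<lambda>x y. weight (x, y) * f (x, y)"] cont
    by (simp add: cbox_Pair_eq)
  finally show "integral\<^sup>L (mu N h) f =
      integral {-1..1} (\<lambda>y. integral {-1..1} (\<lambda>x. weight (x, y) * f (x, y)))" .
qed

section \<open>Orthogonality to monomials and to their linear combinations\<close>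

lemma continuous_p [continuous_intros]:
  "continuous_on UNIV (\<lambda>(x, y). p N h n k x y * (x ^ i * y ^ j))"
  unfolding p_def q_def case_prod_beta by (intro continuous_intros)

lemma integral_p_monomial:
  assumes "k \<le> n" and ij: "(i, j) <\<^sub>t\<^sub>d (k, n - k)"
  shows "(\<integral>(x, y). p N h n k x y * (x ^ i * y ^ j) \<partial>mu N h) = 0"
proof -
  obtain P where P: "deg_le (int i - (int k + 1) + 1) P"
    "\<And>y. y \<in> {-1..1} \<Longrightarrow> power_moment i (int k + 1) y = \<i> * of_real (poly P y)"
    using power_moment_poly by blast
  let ?U = "chebyshev_U (int n - int k)"
  have inner: "integral {-1..1} (\<lambda>x. weight (x, y) * (p N h n k x y * (x ^ i * y ^ j)))
      = 2 / pi\<^sup>2 * (sqrt (1 - y\<^sup>2) * poly ?U y * poly (monom 1 j * P) y)" if y: "y \<in> {-1..1}" for y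
  proof -
    have "integral {-1..1} (\<lambda>x. weight (x, y) * (p N h n k x y * (x ^ i * y ^ j)))
      = integral {-1..1} (\<lambda>x. (4 / pi\<^sup>2 * sqrt (1 - y\<^sup>2) * poly ?U y * y ^ j) * (x ^ i * q N h k x y *
      (sqrt (1 - x\<^sup>2) / (cmod (hpoly N h (cis (arccos x)) y))\<^sup>2)))"
      by (intro integral_cong) (simp add: weight_def p_def mult_ac)
    also have "\<dots> = (4 / pi\<^sup>2 * sqrt (1 - y\<^sup>2) * poly ?U y * y ^ j) * (poly P y / 2)"
      using y by (simp only: integral_mult_right integral_q P atLeastAtMost_iff) simp
    finally show ?thesis
      by (simp add: poly_monom)
  qed
  have "integral {-1..1} (\<lambda>y. sqrt (1 - y\<^sup>2) * poly ?U y * poly (monom 1 j * P) y) = 0"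
  \<comment> \<open>Below \<open>k\<close> the integral over x already vanishes, whatever
    \<open>j\<close> is; from \<open>k\<close> on, the integral over \<open>y\<close> does.\<close>
  proof (cases "i < k")
    case True
    then have "P = 0"
      using P(1) by (intro poly_eqI) (auto simp: deg_le_def)
    then show ?thesis by simp
  next
    case False
    \<comment> \<open>As \<open>i \<ge> k\<close>, the tie i + j = n in the ordering is excluded, so
      i + j < n.\<close>
    then have "int j + (int i - (int k + 1) + 1) < int n - int k"
      using ij \<open>k \<le> n\<close> by (auto simp: td_less_def)
    then show ?thesis
      by (intro integral_chebyshev_U_orthogonal[OF deg_le_mult[OF degree_monom_le P(1)]])
  qed
  then have "integral {-1..1} (\<lambda>y. 2 / pi\<^sup>2 *
      (sqrt (1 - y\<^sup>2) * poly ?U y * poly (monom 1 j * P) y)) = 0"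
    by (simp only: integral_mult_right mult_zero_right)
  also have "integral {-1..1} (\<lambda>y. 2 / pi\<^sup>2 *
      (sqrt (1 - y\<^sup>2) * poly ?U y * poly (monom 1 j * P) y))
    = integral {-1..1} (\<lambda>y. integral {-1..1} (\<lambda>x. weight (x, y) * (p N h n k x y * (x ^ i * y ^ j))))"
    using inner by (intro integral_cong) auto
  finally show ?thesis
    by (subst integral_mu[OF continuous_p]) simp
qed

text \<open>Linearity over finitely many monomials; integrability of each term also yields the
  integrability that \<open>orthogonal_wrt\<close> demands.\<close>

lemma orthogonal_p:
  assumes "k \<le> n" and "poly_degree_less r (k, n - k)"
  shows "orthogonal_wrt (mu N h) (p N h n k) r"
proof -
  obtain c where c: "\<And>x y. r x y = (\<Sum>(i, j) \<in> {a. a <\<^sub>t\<^sub>d (k, n - k)}. c (i, j) * x ^ i * y ^ j)"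
    using assms(2) by (auto simp: poly_degree_less_def)
  define f where "f = (\<lambda>(i, j). \<lambda>(x, y). p N h n k x y * (x ^ i * y ^ j))"
  have pr: "(\<lambda>(x, y). p N h n k x y * r x y) = (\<lambda>z. \<Sum>a\<in>{a. a <\<^sub>t\<^sub>d (k, n - k)}. c a * f a z)"
    by (auto simp: fun_eq_iff c f_def sum_distrib_left case_prod_beta mult_ac intro!: sum.cong)
  have int: "integrable (mu N h) (f a)" for a
    unfolding f_def by (cases a) (simp add: integrable_mu continuous_p)
  have zero: "integral\<^sup>L (mu N h) (f a) = 0" if "a <\<^sub>t\<^sub>d (k, n - k)" for a
    using integral_p_monomial[OF assms(1), of "fst a" "snd a"] that by (simp add: f_def case_prod_beta)
  show ?thesis
    unfolding orthogonal_wrt_def pr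
    using int zero by (simp add: Bochner_Integration.integral_sum)
qed

end

theorem theorem3p3:
  fixes N n k :: nat and h :: "nat \<Rightarrow> real poly"
  assumes "N \<ge> 1"
    and "h 0 = 1"
    and "\<And>i. i \<le> N \<Longrightarrow> real (degree (h i)) \<le> real N / 2 - \<bar>real N / 2 - real i\<bar>"
    and "\<And>z y. cmod z \<le> 1 \<Longrightarrow> -1 \<le> y \<Longrightarrow> y \<le> 1 \<Longrightarrow> hpoly N h z y \<noteq> 0"
    and "\<lceil>(real N - 2) / 2\<rceil> \<le> int k"
    and "k \<le> n"
  shows "\<forall>r. poly_degree_less r (k, n - k) \<longrightarrow> orthogonal_wrt (mu N h) (p N h n k) r"
proof -
  \<comment> \<open>From |N/2 - i| \<ge> N/2 - i, the assumed bound is at most i.\<close>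
  have "degree (h i) \<le> i" if "i \<le> N" for i
    using assms(3)[OF that] by linarith
  then interpret stable_polynomial N h
    using assms(2,4) by unfold_locales
  show ?thesis
    using orthogonal_p[OF \<open>k \<le> n\<close>] by blast
qed

end
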